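(* Let $Z_1,\dots,Z_n$ be random variables in a measurable space $\mathcal{Z}$, let $m$ be a model (a set), let $\gamma$ be a contrast assigning to each $s\in m$ a function $\gamma(s):\mathcal{Z}\to\mathbb{R}$, write $P_n(\gamma(s))=\frac1n\sum_{i=1}^n\gamma(s)(Z_i)$, and let $\widehat{s}_m\in\arg\min_{s\in m}P_n(\gamma(s))$ be an M-estimator on $m$, assumed to exist. Let $\mathcal{F}:m\to\mathbb{R}_+$ be a nonnegative functional and, for $C\ge0$, set $$m_C=\{s\in m:\mathcal{F}(s)\le C\},\qquad d_C=\{s\in m:\mathcal{F}(s)=C\}.$$ Then $$\mathcal{F}(\widehat{s}_m)\in\arg\min_{C\ge0}\left\{\inf_{s\in d_C}P_n(\gamma(s))\right\}$$ and $$\mathcal{F}(\widehat{s}_m)\in\arg\min_{C\ge0}\left\{\inf_{s\in m_C}P_n(\gamma(s))\right\}.$$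
   Context: The infimum over an empty set is $+\infty$. *)

theory Defs
  imports "HOL-Probability.Probability"
begin

definition empirical_mean :: "nat \<Rightarrow> (nat \<Rightarrow> 'w \<Rightarrow> 'z) \<Rightarrow> 'w \<Rightarrow> ('z \<Rightarrow> real) \<Rightarrow> real" where
  "empirical_mean n Z \<omega> f = (1 / real n) * (\<Sum>i=1..n. f (Z i \<omega>))"

definition model_le :: "'s set \<Rightarrow> ('s \<Rightarrow> real) \<Rightarrow> real \<Rightarrow> 's set" where
  "model_le m F C = {s \<in> m. F s \<le> C}"

definition model_eq :: "'s set \<Rightarrow> ('s \<Rightarrow> real) \<Rightarrow> real \<Rightarrow> 's set" where
  "model_eq m F C = {s \<in> m. F s = C}"

text \<open>The infimum is taken in the extended reals, where \<open>Inf {} = \<infinity>\<close>. On the reals,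
  \<open>Inf\<close> of the empty set is an unspecified real number.\<close>

definition inf_empirical_risk ::
  "nat \<Rightarrow> (nat \<Rightarrow> 'w \<Rightarrow> 'z) \<Rightarrow> ('s \<Rightarrow> 'z \<Rightarrow> real) \<Rightarrow> 'w \<Rightarrow> 's set \<Rightarrow> ereal" where
  "inf_empirical_risk n Z \<gamma> \<omega> A = (INF s\<in>A. ereal (empirical_mean n Z \<omega> (\<gamma> s)))"

text \<open>An M-estimator is a random element of the model (a function of the outcome) minimising
  the empirical risk for every outcome; no measurability of it is required.\<close>

definition M_estimator ::
  "'w measure \<Rightarrow> nat \<Rightarrow> (nat \<Rightarrow> 'w \<Rightarrow> 'z) \<Rightarrow> ('s \<Rightarrow> 'z \<Rightarrow> real) \<Rightarrow> 's set \<Rightarrow> ('w \<Rightarrow> 's) \<Rightarrow> bool" where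
  "M_estimator M n Z \<gamma> m s_hat \<longleftrightarrow>
    (\<forall>\<omega>\<in>space M. is_arg_min (\<lambda>s. empirical_mean n Z \<omega> (\<gamma> s)) (\<lambda>s. s \<in> m) (s_hat \<omega>))"

end

theory Submission
  imports Defs
begin

text \<open>Fix an outcome. The estimator belongs to the set indexed by its own value C0 of
  \<open>F\<close>, so the infimum over that set is at most its risk. Every set of either family
  lies inside \<open>m\<close>, so no infimum can fall below the minimal risk over \<open>m\<close>,
  which is exactly that risk. Hence C0 minimises the outer problem. The argument uses only
  membership and inclusion in \<open>m\<close>, so one lemma about a family \<open>A\<close> of
  subsets of \<open>m\<close> serves both for \<open>model_eq\<close> and for
  \<open>model_le\<close>.\<close>

lemma is_arg_min_inf_empirical_risk:
  assumes min: "is_arg_min (\<lambda>s. empirical_mean n Z \<omega> (\<gamma> s)) (\<lambda>s. s \<in> m) s0"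
    and sub: "\<And>C. A C \<subseteq> m"
    and "s0 \<in> A C0" and "P C0"
  shows "is_arg_min (\<lambda>C. inf_empirical_risk n Z \<gamma> \<omega> (A C)) P C0"
proof -
  have "inf_empirical_risk n Z \<gamma> \<omega> (A C0) \<le> inf_empirical_risk n Z \<gamma> \<omega> (A C)" for C
  proof -
    have "inf_empirical_risk n Z \<gamma> \<omega> (A C0) \<le> ereal (empirical_mean n Z \<omega> (\<gamma> s0))"
      unfolding inf_empirical_risk_def using \<open>s0 \<in> A C0\<close> by (rule INF_lower)
    \<comment> \<open>The risk of \<open>s0\<close> bounds from below all risks on \<open>m\<close>,
      hence on \<open>A C\<close>; if \<open>A C\<close> is empty, the right side is \<infinity> and
      the bound is trivial.\<close>
    also have "\<dots> \<le> inf_empirical_risk n Z \<gamma> \<omega> (A C)"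
      unfolding inf_empirical_risk_def
      using min sub[of C] by (intro INF_greatest) (auto simp: is_arg_min_linorder)
    finally show ?thesis .
  qed
  then show ?thesis
    using \<open>P C0\<close> by (simp add: is_arg_min_linorder)
qed

theorem proposition5p3:
  fixes M :: "'w measure" and N :: "'z measure"
    and n :: nat and Z :: "nat \<Rightarrow> 'w \<Rightarrow> 'z"
    and m :: "'s set" and \<gamma> :: "'s \<Rightarrow> 'z \<Rightarrow> real"
    and s_hat :: "'w \<Rightarrow> 's" and F :: "'s \<Rightarrow> real"
  assumes "prob_space M"
    and "n \<ge> 1"
    and "\<And>i. i \<in> {1..n} \<Longrightarrow> Z i \<in> measurable M N"
    and "M_estimator M n Z \<gamma> m s_hat"
    and "\<And>s. s \<in> m \<Longrightarrow> F s \<ge> 0"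
  shows "\<forall>\<omega>\<in>space M.
      is_arg_min (\<lambda>C. inf_empirical_risk n Z \<gamma> \<omega> (model_eq m F C)) (\<lambda>C. C \<ge> 0) (F (s_hat \<omega>)) \<and>
      is_arg_min (\<lambda>C. inf_empirical_risk n Z \<gamma> \<omega> (model_le m F C)) (\<lambda>C. C \<ge> 0) (F (s_hat \<omega>))"
proof
  fix \<omega> assume "\<omega> \<in> space M"
  then have min: "is_arg_min (\<lambda>s. empirical_mean n Z \<omega> (\<gamma> s)) (\<lambda>s. s \<in> m) (s_hat \<omega>)"
    using assms(4) by (simp add: M_estimator_def)
  then have "s_hat \<omega> \<in> m"
    by (simp add: is_arg_min_def)
  then show "is_arg_min (\<lambda>C. inf_empirical_risk n Z \<gamma> \<omega> (model_eq m F C)) (\<lambda>C. C \<ge> 0) (F (s_hat \<omega>)) \<and>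
      is_arg_min (\<lambda>C. inf_empirical_risk n Z \<gamma> \<omega> (model_le m F C)) (\<lambda>C. C \<ge> 0) (F (s_hat \<omega>))"
    \<comment> \<open>Nonnegativity of \<open>F\<close> on \<open>m\<close> makes
      \<open>F (s_hat \<omega>)\<close> an admissible C; \<open>s_hat \<omega>\<close> lies in both
      sets at this C by reflexivity of = and \<le>.\<close>
    using assms(5)
    by (intro conjI is_arg_min_inf_empirical_risk[OF min]) (auto simp: model_eq_def model_le_def)
qed

end
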